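(* Let $\ell\ge1$, let $\mathcal A$ be a finite alphabet, and let $F$ be a PCA with alphabet $\mathcal A$, neighborhood $\{0,\ldots,\ell\}$ and transition probabilities $\theta^k_{x_0\cdots x_\ell}$. Let $p=(p_i)_{i\in\mathcal A}$ be a probability vector with $p_i>0$ for all $i$. The Bernoulli product measure $\mu_p$ is an invariant measure of $F$ (that is, $\mu_pF=\mu_p$) if one of the two following conditions is satisfied: $$\forall x_0,\ldots,x_{\ell-1}\in\mathcal A,\ \forall k\in\mathcal A,\quad \sum_{i\in\mathcal A}p_i\,\theta^k_{x_0\cdots x_{\ell-1}i}=p_k;$$ $$\forall x_0,\ldots,x_{\ell-1}\in\mathcal A,\ \forall k\in\mathcal A,\quad \sum_{i\in\mathcal A}p_i\,\theta^k_{i\,x_0\cdots x_{\ell-1}}=p_k.$$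
   Context: A PCA with alphabet $\mathcal A$ and neighborhood $\{0,\ldots,\ell\}$ is given by transition probabilities $\theta^k_{x_0\cdots x_\ell}\ge0$ with $\sum_{k\in\mathcal A}\theta^k_{x_0\cdots x_\ell}=1$: the new value of cell $j\in\mathbb Z$ equals $k$ with probability $\theta^k_{x_0\cdots x_\ell}$ when the current values of cells $j,\ldots,j+\ell$ are $x_0,\ldots,x_\ell$, independently for different cells. For a probability measure $\mu$ on $\mathcal A^{\mathbb Z}$, $\mu F$ is the law of the configuration obtained by applying one step of the PCA to a configuration of law $\mu$. $\mu_p$ is the product measure on $\mathcal A^{\mathbb Z}$ in which each coordinate equals $i$ with probability $p_i$. *)

theory Defs
  imports "HOL-Probability.Probability"
begin

text \<open>
  The alphabet is a type of class \<^class>\<open>finite\<close>; configurations are functions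
  \<^typ>\<open>int \<Rightarrow> 'a\<close>. A local rule of neighborhood \<open>{0..l}\<close> is a function \<open>\<theta>\<close> for which
  \<open>\<theta> [x\<^sub>0, \<dots>, x\<^sub>l] k\<close> is the probability of the new value \<open>k\<close>; its values on words whose
  length is not \<open>l + 1\<close> are irrelevant.
\<close>

definition prob_vector :: "('a::finite \<Rightarrow> real) \<Rightarrow> bool" where
  "prob_vector p \<longleftrightarrow> (\<forall>i. 0 \<le> p i) \<and> (\<Sum>i\<in>UNIV. p i) = 1"

definition transition_probs :: "nat \<Rightarrow> ('a::finite list \<Rightarrow> 'a \<Rightarrow> real) \<Rightarrow> bool" where
  "transition_probs l \<theta> \<longleftrightarrow> (\<forall>w. length w = Suc l \<longrightarrow> prob_vector (\<theta> w))"

definition letter_measure :: "('a::finite \<Rightarrow> real) \<Rightarrow> 'a measure" where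
  "letter_measure p = point_measure UNIV (\<lambda>i. ennreal (p i))"

definition config_space :: "(int \<Rightarrow> 'a::finite) measure" where
  "config_space = PiM UNIV (\<lambda>_. count_space UNIV)"

definition bernoulli_measure :: "('a::finite \<Rightarrow> real) \<Rightarrow> (int \<Rightarrow> 'a) measure" where
  "bernoulli_measure p = PiM UNIV (\<lambda>_. letter_measure p)"

definition window :: "nat \<Rightarrow> (int \<Rightarrow> 'a) \<Rightarrow> int \<Rightarrow> 'a list" where
  "window l x j = map (\<lambda>n. x (j + int n)) [0..<Suc l]"

text \<open>The law of the updated configuration, given the current configuration \<open>x\<close>.\<close>

definition pca_kernel ::
    "nat \<Rightarrow> ('a::finite list \<Rightarrow> 'a \<Rightarrow> real) \<Rightarrow> (int \<Rightarrow> 'a) \<Rightarrow> (int \<Rightarrow> 'a) measure" where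
  "pca_kernel l \<theta> x = PiM UNIV (\<lambda>j. letter_measure (\<theta> (window l x j)))"

lemma sets_letter_measure [simp]: "sets (letter_measure p) = UNIV"
  and space_letter_measure [simp]: "space (letter_measure p) = UNIV"
  by (simp_all add: letter_measure_def sets_point_measure space_point_measure)

lemma emeasure_letter_measure:
  assumes "\<And>i. 0 \<le> p i"
  shows "emeasure (letter_measure p) A = ennreal (\<Sum>i\<in>A. p i)"
  using assms by (simp add: letter_measure_def emeasure_point_measure_finite)

lemma prob_space_letter_measure:
  assumes "prob_vector p"
  shows "prob_space (letter_measure p)"
  using assms by (intro prob_spaceI) (simp add: emeasure_letter_measure prob_vector_def)

lemma length_window [simp]: "length (window l x j) = Suc l"
  by (simp add: window_def)

lemma prob_space_letter_window:
  assumes "transition_probs l \<theta>"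
  shows "prob_space (letter_measure (\<theta> (window l x j)))"
  using assms by (intro prob_space_letter_measure) (simp add: transition_probs_def)

lemma measurable_window:
  "(\<lambda>x. window l x j) \<in> measurable config_space (count_space UNIV)"
proof -
  have "(\<lambda>x. map (\<lambda>n. x (j + int n)) ns) \<in> measurable config_space (count_space UNIV)" for ns
  proof (induction ns)
    case (Cons n ns)
    have [measurable]: "(\<lambda>x. x (j + int n)) \<in> measurable config_space (count_space UNIV)"
      unfolding config_space_def by measurable
    note [measurable] = Cons.IH
    show ?case
      by simp
  qed simp
  then show ?thesis
    unfolding window_def .
qed

text \<open>
  The monadic bind in \<open>pca_step\<close> is meaningful because \<open>pca_kernel\<close> is a Markov kernel.
\<close>

lemma measurable_pca_kernel:
  assumes "transition_probs l \<theta>"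
  shows "pca_kernel l \<theta> \<in> measurable config_space (prob_algebra config_space)"
proof (rule measurable_prob_algebra_generated)
  let ?M = "\<lambda>_::int. count_space UNIV :: 'a measure"
  show "sets (config_space :: (int \<Rightarrow> 'a) measure) = 
      sigma_sets (\<Pi>\<^sub>E i\<in>UNIV. space (?M i)) (prod_algebra UNIV ?M)"
    unfolding config_space_def by (rule sets_PiM)
  show "Int_stable (prod_algebra UNIV ?M)"
    by (rule Int_stable_prod_algebra)
  show "prod_algebra UNIV ?M \<subseteq> Pow (\<Pi>\<^sub>E i\<in>UNIV. space (?M i))"
    by (rule prod_algebra_sets_into_space)
  show "prob_space (pca_kernel l \<theta> x)" for x
    unfolding pca_kernel_def by (intro prob_space_PiM prob_space_letter_window assms)
  show "sets (pca_kernel l \<theta> x) = sets config_space" for x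
    unfolding pca_kernel_def config_space_def by (intro sets_PiM_cong) auto
  fix A assume "A \<in> prod_algebra UNIV ?M"
  then obtain J E where J: "finite J" and A: "A = prod_emb UNIV ?M J (Pi\<^sub>E J E)"
    by (rule prod_algebraE) blast
  have "emeasure (pca_kernel l \<theta> x) A
      = (\<Prod>j\<in>J. emeasure (letter_measure (\<theta> (window l x j))) (E j))" for x
  proof -
    interpret product_prob_space "\<lambda>j. letter_measure (\<theta> (window l x j))" UNIV
      by (intro product_prob_spaceI prob_space_letter_window assms)
    have "A = prod_emb UNIV (\<lambda>j. letter_measure (\<theta> (window l x j))) J (Pi\<^sub>E J E)"
      by (simp add: A prod_emb_def)
    then show ?thesis
      unfolding pca_kernel_def using J by (simp add: emeasure_PiM_emb)
  qed
  moreover have "(\<lambda>x. emeasure (letter_measure (\<theta> (window l x j))) (E j))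
      \<in> borel_measurable config_space" for j
    by (rule measurable_compose[OF measurable_window]) simp
  ultimately show "(\<lambda>x. emeasure (pca_kernel l \<theta> x) A) \<in> borel_measurable config_space"
    by simp
qed

definition pca_step ::
    "nat \<Rightarrow> ('a::finite list \<Rightarrow> 'a \<Rightarrow> real) \<Rightarrow> (int \<Rightarrow> 'a) measure \<Rightarrow> (int \<Rightarrow> 'a) measure" where
  "pca_step l \<theta> \<mu> = \<mu> \<bind> pca_kernel l \<theta>"

definition pca_invariant ::
    "nat \<Rightarrow> ('a::finite list \<Rightarrow> 'a \<Rightarrow> real) \<Rightarrow> (int \<Rightarrow> 'a) measure \<Rightarrow> bool" where
  "pca_invariant l \<theta> \<mu> \<longleftrightarrow> pca_step l \<theta> \<mu> = \<mu>"

end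

theory Submission
  imports Defs
begin

text \<open>
  Fix finitely many cells \<open>J\<close> and target sets \<open>E j\<close>. Given the configuration \<open>x\<close>, the updated
  cells are independent, so under one step of the automaton the cylinder
  \<open>{y. \<forall>j\<in>J. y j \<in> E j}\<close> has probability
  \<open>\<integral> (\<Prod>j\<in>J. h j x) \<partial>\<mu>\<^sub>p\<close>, where \<open>h j x\<close> is the probability that cell \<open>j\<close> lands in \<open>E j\<close>. The
  factors overlap, since neighboring windows share sites. Nevertheless the integral factorizes:
  under the first condition, the rightmost window, that of \<open>j = Max J\<close>, contains the site
  \<open>j + l\<close>, which the window of no other cell in \<open>J\<close> meets. Averaging over the letter at that site alone, with all
  others held fixed, leaves the other factors untouched and turns \<open>h j x\<close> into the constant
  \<open>\<mu>\<^sub>p(y j \<in> E j)\<close>, because the condition says exactly that a fresh \<open>p\<close>-distributed last letter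
  makes the updated cell \<open>p\<close>-distributed. Peeling off the cells of \<open>J\<close> from right to left gives
  \<open>\<Prod>j\<in>J. \<mu>\<^sub>p(y j \<in> E j)\<close>, the Bernoulli probability of the cylinder. Under the second condition
  the roles are mirrored: among the windows of the cells in \<open>J\<close>, the site \<open>j = Min J\<close> belongs to
  the leftmost one only, and the cells are peeled off from left to right.

  Averaging over a single site of an infinite product is
  \<open>nn_integral_PiM_resample\<close>; the peeling step is \<open>peel_refreshed_cell\<close>; and a probability
  measure on configurations is determined by its values on cylinders.
\<close>

section \<open>Resampling one coordinate of a product measure\<close>

text \<open>
  In an independent family, replacing one coordinate by an independent copy does not change the
  law of the family; Fubini's theorem then separates the new copy from the rest.
\<close>

lemma nn_integral_PiM_resample:
  fixes M :: "'i \<Rightarrow> 'b measure"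
  assumes M: "\<And>i. i \<in> I \<Longrightarrow> prob_space (M i)" and i: "i \<in> I"
    and f: "f \<in> borel_measurable (PiM I M)"
  shows "(\<integral>\<^sup>+x. f x \<partial>PiM I M) = (\<integral>\<^sup>+x. \<integral>\<^sup>+a. f (x(i := a)) \<partial>M i \<partial>PiM I M)"
proof -
  interpret Mi: prob_space "M i"
    using M i .
  interpret P: prob_space "PiM I M"
    using M by (rule prob_space_PiM)
  interpret pair_sigma_finite "M i" "PiM I M" ..
  have I: "insert i I = I"
    using i by auto
  have upd: "(\<lambda>(a, x). x(i := a)) \<in> measurable (M i \<Otimes>\<^sub>M PiM I M) (PiM I M)"
    using measurable_fun_upd[of I I i snd "M i \<Otimes>\<^sub>M PiM I M" M fst] I
    by (simp add: case_prod_beta')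
  have "(\<integral>\<^sup>+x. f x \<partial>PiM I M)
      = (\<integral>\<^sup>+x. f x \<partial>distr (M i \<Otimes>\<^sub>M PiM I M) (PiM I M) (\<lambda>(a, x). x(i := a)))"
    using distr_pair_PiM_eq_PiM[of I M i, OF M] M i I by simp
  also have "\<dots> = (\<integral>\<^sup>+(a, x). f (x(i := a)) \<partial>(M i \<Otimes>\<^sub>M PiM I M))"
    using upd f by (subst nn_integral_distr) (simp_all add: case_prod_beta')
  also have "\<dots> = (\<integral>\<^sup>+x. \<integral>\<^sup>+a. f (x(i := a)) \<partial>M i \<partial>PiM I M)"
    using measurable_compose[OF upd f]
    by (subst nn_integral_snd[symmetric]) (simp_all add: case_prod_beta')
  finally show ?thesis .
qed

lemma nn_integral_PiM_mult_resampled: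
  fixes M :: "'i \<Rightarrow> 'b measure"
  assumes M: "\<And>i. i \<in> I \<Longrightarrow> prob_space (M i)" and i: "i \<in> I"
    and g [measurable]: "g \<in> borel_measurable (PiM I M)"
    and h [measurable]: "h \<in> borel_measurable (PiM I M)"
    and g_indep: "\<And>x a. g (x(i := a)) = g x"
    and h_average: "\<And>x. x \<in> space (PiM I M) \<Longrightarrow> (\<integral>\<^sup>+a. h (x(i := a)) \<partial>M i) = c"
  shows "(\<integral>\<^sup>+x. h x * g x \<partial>PiM I M) = c * (\<integral>\<^sup>+x. g x \<partial>PiM I M)"
proof -
  have "(\<integral>\<^sup>+x. h x * g x \<partial>PiM I M)
      = (\<integral>\<^sup>+x. \<integral>\<^sup>+a. h (x(i := a)) * g x \<partial>M i \<partial>PiM I M)"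
    by (subst nn_integral_PiM_resample[OF M i]) (simp_all add: g_indep)
  also have "\<dots> = (\<integral>\<^sup>+x. c * g x \<partial>PiM I M)"
  proof (rule nn_integral_cong)
    fix x assume x: "x \<in> space (PiM I M)"
    have "(\<lambda>a. x(i := a)) \<in> measurable (M i) (PiM I M)"
      using x i by (intro measurable_fun_upd[where J=I]) auto
    from measurable_compose[OF this h]
    show "(\<integral>\<^sup>+a. h (x(i := a)) * g x \<partial>M i) = c * g x"
      by (simp add: nn_integral_multc h_average[OF x])
  qed
  also have "\<dots> = c * (\<integral>\<^sup>+x. g x \<partial>PiM I M)"
    by (rule nn_integral_cmult) fact
  finally show ?thesis .
qed

section \<open>Sites that refresh an updated cell\<close>

text \<open>
  Site \<open>r\<close> refreshes cell \<open>j\<close> if drawing a new letter of law \<open>p\<close> at \<open>r\<close> gives the updated cell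
  \<open>j\<close> the law \<open>p\<close>, whatever the other letters are. Both summation conditions on \<open>\<theta>\<close> have this
  form, with \<open>r = j + l\<close> and \<open>r = j\<close> respectively.
\<close>

definition refreshes ::
    "nat \<Rightarrow> ('a::finite list \<Rightarrow> 'a \<Rightarrow> real) \<Rightarrow> ('a \<Rightarrow> real) \<Rightarrow> int \<Rightarrow> int \<Rightarrow> bool" where
  "refreshes l \<theta> p r j \<longleftrightarrow>
     (\<forall>x E. (\<integral>\<^sup>+a. emeasure (letter_measure (\<theta> (window l (x(r := a)) j))) E \<partial>letter_measure p)
        = emeasure (letter_measure p) E)"

lemma refreshesI:
  assumes \<theta>: "transition_probs l \<theta>" and p: "prob_vector p"
    and average: "\<And>x k. (\<Sum>a\<in>UNIV. p a * \<theta> (window l (x(r := a)) j) k) = p k"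
  shows "refreshes l \<theta> p r j"
  unfolding refreshes_def
proof (intro allI)
  fix x E
  have p_nonneg: "0 \<le> p a" for a
    using p by (simp add: prob_vector_def)
  have \<theta>_nonneg: "0 \<le> \<theta> (window l y i) k" for y i k
    using \<theta> by (simp add: transition_probs_def prob_vector_def)
  have "(\<integral>\<^sup>+a. emeasure (letter_measure (\<theta> (window l (x(r := a)) j))) E \<partial>letter_measure p)
      = (\<Sum>a\<in>UNIV. ennreal (p a * (\<Sum>k\<in>E. \<theta> (window l (x(r := a)) j) k)))"
    unfolding letter_measure_def[of p]
    by (simp add: nn_integral_point_measure_finite emeasure_letter_measure \<theta>_nonneg p_nonneg
        ennreal_mult sum_nonneg)
  also have "\<dots> = ennreal (\<Sum>a\<in>UNIV. p a * (\<Sum>k\<in>E. \<theta> (window l (x(r := a)) j) k))"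
    by (intro sum_ennreal mult_nonneg_nonneg sum_nonneg p_nonneg \<theta>_nonneg)
  also have "(\<Sum>a\<in>UNIV. p a * (\<Sum>k\<in>E. \<theta> (window l (x(r := a)) j) k)) = (\<Sum>k\<in>E. p k)"
    unfolding sum_distrib_left by (subst sum.swap) (simp add: average)
  also have "ennreal (\<Sum>k\<in>E. p k) = emeasure (letter_measure p) E"
    by (simp add: emeasure_letter_measure p_nonneg)
  finally show "(\<integral>\<^sup>+a. emeasure (letter_measure (\<theta> (window l (x(r := a)) j))) E \<partial>letter_measure p)
      = emeasure (letter_measure p) E" .
qed

lemma window_update_last:
  "window l (x(j + int l := a)) j = map (\<lambda>n. x (j + int n)) [0..<l] @ [a]"
  by (simp add: window_def)

lemma window_update_first:
  "window l (x(j := a)) j = a # map (\<lambda>n. x (j + int (Suc n))) [0..<l]"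
  unfolding window_def by (subst upt_conv_Cons) (simp_all add: map_Suc_upt[symmetric] del: upt_Suc)

lemma window_update_outside:
  assumes "r \<notin> {j..j + int l}"
  shows "window l (x(r := a)) j = window l x j"
  using assms by (auto simp: window_def simp del: upt_Suc)

section \<open>Factorization over the updated cells\<close>

lemma sets_bernoulli_measure: "sets (bernoulli_measure p) = sets config_space"
  unfolding bernoulli_measure_def config_space_def by (intro sets_PiM_cong) auto

lemma borel_measurable_cell_prob:
  "(\<lambda>x. emeasure (letter_measure (\<theta> (window l x j))) E) \<in> borel_measurable (bernoulli_measure p)"
  unfolding measurable_cong_sets[OF sets_bernoulli_measure refl]
  by (rule measurable_compose[OF measurable_window]) simp

text \<open>
  If the refreshing site \<open>r\<close> of cell \<open>j\<close> lies in the window of no cell in \<open>J\<close>, then averaging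
  over the letter at \<open>r\<close> acts on the factor of \<open>j\<close> only.
\<close>

lemma peel_refreshed_cell:
  assumes p: "prob_vector p" and J: "finite J" "j \<notin> J"
    and refresh: "refreshes l \<theta> p r j"
    and outside: "\<And>i. i \<in> J \<Longrightarrow> r \<notin> {i..i + int l}"
  shows "(\<integral>\<^sup>+x. (\<Prod>i\<in>insert j J. emeasure (letter_measure (\<theta> (window l x i))) (E i))
        \<partial>bernoulli_measure p)
    = emeasure (letter_measure p) (E j) *
      (\<integral>\<^sup>+x. (\<Prod>i\<in>J. emeasure (letter_measure (\<theta> (window l x i))) (E i)) \<partial>bernoulli_measure p)"
proof -
  note meas = borel_measurable_cell_prob[of \<theta> l _ _ p, unfolded bernoulli_measure_def]
  show ?thesis
    unfolding prod.insert[OF J] bernoulli_measure_def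
  proof (rule nn_integral_PiM_mult_resampled[where i = r])
    show "(\<Prod>i\<in>J. emeasure (letter_measure (\<theta> (window l (x(r := a)) i))) (E i))
        = (\<Prod>i\<in>J. emeasure (letter_measure (\<theta> (window l x i))) (E i))" for x a
      using outside by (intro prod.cong refl) (simp add: window_update_outside)
    show "(\<integral>\<^sup>+a. emeasure (letter_measure (\<theta> (window l (x(r := a)) j))) (E j) \<partial>letter_measure p)
        = emeasure (letter_measure p) (E j)" for x
      using refresh by (simp add: refreshes_def)
  qed (auto intro!: borel_measurable_prod_ennreal meas prob_space_letter_measure p)
qed

text \<open>
  The order of peeling is dictated by the location of the refreshing site: \<open>j + l\<close> avoids the
  windows of all cells to the left of \<open>j\<close>, and \<open>j\<close> avoids those of all cells to the right.
\<close>

lemma expected_cylinder_prob: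
  assumes p: "prob_vector p" and J: "finite J"
    and refresh: "(\<forall>j. refreshes l \<theta> p (j + int l) j) \<or> (\<forall>j. refreshes l \<theta> p j j)"
  shows "(\<integral>\<^sup>+x. (\<Prod>j\<in>J. emeasure (letter_measure (\<theta> (window l x j))) (E j)) \<partial>bernoulli_measure p)
    = (\<Prod>j\<in>J. emeasure (letter_measure p) (E j))"
proof -
  interpret prob_space "bernoulli_measure p"
    unfolding bernoulli_measure_def by (intro prob_space_PiM prob_space_letter_measure p)
  from refresh show ?thesis
  proof
    assume last: "\<forall>j. refreshes l \<theta> p (j + int l) j"
    from J show ?thesis
    proof (induction J rule: finite_linorder_max_induct)
      case (insert j J)
      then have "j \<notin> J"
        by auto
      with insert show ?case
        by (subst peel_refreshed_cell[OF p, where r = "j + int l"]) (auto simp: last)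
    qed (simp add: emeasure_space_1)
  next
    assume first: "\<forall>j. refreshes l \<theta> p j j"
    from J show ?thesis
    proof (induction J rule: finite_linorder_min_induct)
      case (insert j J)
      then have "j \<notin> J"
        by auto
      with insert show ?case
        by (subst peel_refreshed_cell[OF p, where r = j]) (auto simp: first)
    qed (simp add: emeasure_space_1)
  qed
qed

section \<open>Invariance\<close>

lemma emeasure_pca_kernel_cylinder:
  assumes \<theta>: "transition_probs l \<theta>" and J: "finite J"
  shows "emeasure (pca_kernel l \<theta> x) (prod_emb UNIV (\<lambda>_. letter_measure p) J (Pi\<^sub>E J E))
    = (\<Prod>j\<in>J. emeasure (letter_measure (\<theta> (window l x j))) (E j))"
proof -
  interpret product_prob_space "\<lambda>j. letter_measure (\<theta> (window l x j))" UNIV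
    by (intro product_prob_spaceI prob_space_letter_window \<theta>)
  \<comment> \<open>All letter measures have the same underlying space, so cylinders do not depend on their
    weights.\<close>
  have "prod_emb UNIV (\<lambda>_. letter_measure p) J (Pi\<^sub>E J E)
      = prod_emb UNIV (\<lambda>j. letter_measure (\<theta> (window l x j))) J (Pi\<^sub>E J E)"
    by (simp add: prod_emb_def)
  then show ?thesis
    unfolding pca_kernel_def using J by (simp add: emeasure_PiM_emb)
qed

lemma pca_invariant_bernoulli_if_refreshes:
  assumes \<theta>: "transition_probs l \<theta>" and p: "prob_vector p"
    and refresh: "(\<forall>j. refreshes l \<theta> p (j + int l) j) \<or> (\<forall>j. refreshes l \<theta> p j j)"
  shows "pca_invariant l \<theta> (bernoulli_measure p)"
proof -
  interpret product_prob_space "\<lambda>_::int. letter_measure p" UNIV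
    by (intro product_prob_spaceI prob_space_letter_measure p)
  have \<mu>: "bernoulli_measure p \<in> space (prob_algebra config_space)"
    using P.prob_space_axioms
    by (simp add: space_prob_algebra sets_bernoulli_measure)
       (simp add: bernoulli_measure_def)
  note kernel = measurable_pca_kernel[OF \<theta>]
  have "bernoulli_measure p \<bind> pca_kernel l \<theta> = PiM UNIV (\<lambda>_. letter_measure p)"
  proof (rule PiM_eq)
    show "sets (bernoulli_measure p \<bind> pca_kernel l \<theta>)
        = sets (PiM UNIV (\<lambda>_. letter_measure p))"
      using sets_bind'[OF \<mu> kernel] sets_bernoulli_measure[of p]
      by (simp add: bernoulli_measure_def)
    fix J :: "int set" and E :: "int \<Rightarrow> 'a set"
    assume J: "finite J"
    let ?C = "prod_emb UNIV (\<lambda>_. letter_measure p) J (Pi\<^sub>E J E)"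
    have C: "?C \<in> sets config_space"
      unfolding sets_bernoulli_measure[of p, symmetric] bernoulli_measure_def
      using J by (intro sets_PiM_I) auto
    have "emeasure (bernoulli_measure p \<bind> pca_kernel l \<theta>) ?C
        = (\<integral>\<^sup>+x. (\<Prod>j\<in>J. emeasure (letter_measure (\<theta> (window l x j))) (E j))
            \<partial>bernoulli_measure p)"
      by (simp add: emeasure_bind_prob_algebra[OF \<mu> kernel C] emeasure_pca_kernel_cylinder[OF \<theta> J])
    also have "\<dots> = (\<Prod>j\<in>J. emeasure (letter_measure p) (E j))"
      by (rule expected_cylinder_prob[OF p J refresh])
    finally show "emeasure (bernoulli_measure p \<bind> pca_kernel l \<theta>) ?C
        = (\<Prod>j\<in>J. emeasure (letter_measure p) (E j))" .
  qed
  then show ?thesis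
    by (simp add: pca_invariant_def pca_step_def bernoulli_measure_def)
qed

theorem theorem5p6:
  fixes l :: nat
    and \<theta> :: "'a::finite list \<Rightarrow> 'a \<Rightarrow> real"
    and p :: "'a \<Rightarrow> real"
  assumes "1 \<le> l"
    and "transition_probs l \<theta>"
    and "prob_vector p"
    and "\<And>i. 0 < p i"
    and "(\<forall>xs k. length xs = l \<longrightarrow> (\<Sum>i\<in>UNIV. p i * \<theta> (xs @ [i]) k) = p k) \<or>
         (\<forall>xs k. length xs = l \<longrightarrow> (\<Sum>i\<in>UNIV. p i * \<theta> (i # xs) k) = p k)"
  shows "pca_invariant l \<theta> (bernoulli_measure p)"
proof (rule pca_invariant_bernoulli_if_refreshes[OF assms(2,3)])
  from assms(5) show "(\<forall>j. refreshes l \<theta> p (j + int l) j) \<or> (\<forall>j. refreshes l \<theta> p j j)"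
  proof
    assume "\<forall>xs k. length xs = l \<longrightarrow> (\<Sum>i\<in>UNIV. p i * \<theta> (xs @ [i]) k) = p k"
    then have "refreshes l \<theta> p (j + int l) j" for j
      by (intro refreshesI assms(2,3)) (simp add: window_update_last)
    then show ?thesis
      by blast
  next
    assume "\<forall>xs k. length xs = l \<longrightarrow> (\<Sum>i\<in>UNIV. p i * \<theta> (i # xs) k) = p k"
    then have "refreshes l \<theta> p j j" for j
      by (intro refreshesI assms(2,3)) (simp add: window_update_first)
    then show ?thesis
      by blast
  qed
qed

end
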